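(* Let $\mathcal{A}$ be an infinite sequence of positive integers, and let $\mathbf{m}=\{(k_1,m_1),\dots,(k_r,m_r)\}$ be a configuration of degree $s=\gcd(m_1,\dots,m_r)$. Then no polynomial of degree smaller than $s-1$ can coincide with the function $n\mapsto r_{\mathbf{m}}(n,\mathcal{A})$ for $n$ large enough; that is, there do not exist a polynomial $q$ with $\deg q< s-1$ and an integer $N$ such that $r_{\mathbf{m}}(n,\mathcal{A})=q(n)$ for all integers $n>N$.
   Context: An infinite sequence of positive integers $\mathcal{A}$ is regarded as an infinite set of (distinct) positive integers. A configuration is a set $\mathbf{m}=\{(k_1,m_1),\dots,(k_r,m_r)\}$ with $r\ge 1$, where $0<k_1<k_2<\dots<k_r$ are positive integers and $m_1,\dots,m_r>0$ are positive integers ($m_i$ is called the multiplicity of $k_i$). The degree of $\mathbf{m}$ is $\gcd(m_1,\dots,m_r)$. The representation function $r_{\mathbf{m}}(n,\mathcal{A})$ is the number of different solutions of the equation $$n=k_1(a_{1,1}+\dots+a_{1,m_1})+\dots+k_r(a_{r,1}+\dots+a_{r,m_r}),\qquad a_{i,j}\in\mathcal{A},$$ where solutions are counted as ordered tuples $(a_{i,j})_{1\le i\le r,\,1\le j\le m_i}$; equivalently, $\sum_{n\ge 0} r_{\mathbf{m}}(n,\mathcal{A})z^n=\prod_{i=1}^r f_{\mathcal{A}}(z^{k_i})^{m_i}$, where $f_{\mathcal{A}}(z)=\sum_{a\in\mathcal{A}}z^a$. *)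

theory Defs
  imports Complex_Main "HOL-Library.FuncSet" "HOL-Computational_Algebra.Polynomial"
begin

text \<open>The condition \<open>inj_on fst M\<close> encodes \<open>k\<^sub>1 < \<dots> < k\<^sub>r\<close>: the set \<open>M\<close> is unordered, so only distinctness remains.\<close>

definition is_configuration :: "(nat \<times> nat) set \<Rightarrow> bool" where
  "is_configuration M \<longleftrightarrow>
     finite M \<and> M \<noteq> {} \<and> inj_on fst M \<and> (\<forall>(k, m)\<in>M. 0 < k \<and> 0 < m)"

definition config_degree :: "(nat \<times> nat) set \<Rightarrow> nat" where
  "config_degree M = Gcd (snd ` M)"

text \<open>
  An ordered tuple \<open>a\<^sub>i\<^sub>,\<^sub>j\<close> is a function on the indices \<open>((k\<^sub>i, m\<^sub>i), j)\<close>
  with \<open>1 \<le> j \<le> m\<^sub>i\<close>. It is taken in the extensional function space \<open>PiE\<close>, so that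
  different functions are different tuples.
\<close>

definition solutions :: "(nat \<times> nat) set \<Rightarrow> nat \<Rightarrow> nat set \<Rightarrow> ((nat \<times> nat) \<times> nat \<Rightarrow> nat) set" where
  "solutions M n A =
     {a \<in> (SIGMA (k, m):M. {1..m}) \<rightarrow>\<^sub>E A.
        n = (\<Sum>(k, m)\<in>M. k * (\<Sum>j=1..m. a ((k, m), j)))}"

definition rep :: "(nat \<times> nat) set \<Rightarrow> nat \<Rightarrow> nat set \<Rightarrow> nat" where
  "rep M n A = card (solutions M n A)"

end

theory Submission
  imports Defs "HOL-Analysis.Analysis"
begin

text \<open>
  Write \<open>f\<close> for the generating function of \<open>A\<close>. Because \<open>s\<close> divides every multiplicity,
  \<open>\<Sum>\<^sub>n r(n) z\<^sup>n = g(z)\<^sup>s\<close> with \<open>g(z) = \<Prod>\<^sub>i f(z\<^bsup>k\<^sub>i\<^esup>)\<^bsup>m\<^sub>i/s\<^esup>\<close>, and \<open>g\<close> is again a power series whose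
  coefficients \<open>g\<^sub>n\<close> are natural numbers, infinitely many of them nonzero. If \<open>r\<close> were
  eventually a polynomial of degree less than \<open>s - 1\<close>, then \<open>g(z)\<^sup>s = P(z) / (1 - z)\<^sup>t\<close> for a polynomial
  \<open>P\<close> and some \<open>t < s\<close>; with \<open>t\<close> minimal, \<open>P(1) \<noteq> 0\<close> unless \<open>t = 0\<close>. The number \<open>\<beta> = t/s\<close> lies
  in \<open>[0, 1)\<close>, and on the unit disc \<open>\<bar>g(z)\<bar> = \<bar>P(z)\<bar>\<^bsup>1/s\<^esup> \<bar>1 - z\<bar>\<^bsup>-\<beta>\<^esup>\<close>.

  No power series with natural coefficients and infinitely many nonzero ones behaves like this. On
  the circle of radius \<open>\<surd>y\<close> the modulus of \<open>g\<close> is at most a constant times that of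
  \<open>(1 - z)\<^bsup>-\<beta>\<^esup> = \<Sum>\<^sub>n c\<^sub>n z\<^sup>n\<close>, so by Parseval's identity \<open>\<Sum>\<^sub>n g\<^sub>n\<^sup>2 y\<^sup>n\<close> is at most a constant times \<open>\<Sum>\<^sub>n c\<^sub>n\<^sup>2 y\<^sup>n\<close>. Since
  \<open>c\<^sub>n \<rightarrow> 0\<close> for \<open>\<beta> < 1\<close>, the latter sum is at most \<open>\<epsilon> \<Sum>\<^sub>n c\<^sub>n y\<^sup>n + O(1) = \<epsilon> (1 - y)\<^bsup>-\<beta>\<^esup> + O(1)\<close> for every
  \<open>\<epsilon> > 0\<close>. On the other hand \<open>g\<^sub>n\<^sup>2 \<ge> g\<^sub>n\<close> for natural numbers, so the former sum is at least \<open>g(y)\<close>,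
  which for \<open>t > 0\<close> is at least a positive constant times \<open>(1 - y)\<^bsup>-\<beta>\<^esup>\<close> near \<open>y = 1\<close>. For small \<open>\<epsilon>\<close> this makes
  \<open>g(y)\<close> bounded as \<open>y\<close> tends to 1 from the left, whereas infinitely many positive integer
  coefficients force \<open>g(y) \<rightarrow> \<infinity>\<close>. For \<open>t = 0\<close> boundedness is immediate.

  The analytic heart is \<open>sum_squares_le_if_dominated_by_binomial\<close> together with
  \<open>sum_squares_binomial_coeffs_little_o\<close>; they are combined in
  \<open>nat_power_series_root_of_rational_pole_order\<close>, and \<open>fps_nth_prod_dilated_indicator\<close> translates
  the counting problem into power series.
\<close>

section \<open>Parseval's identity for absolutely summable coefficients\<close>

lemma has_integral_cis_int:
  fixes m :: int
  shows "((\<lambda>t. cis (of_int m * t)) has_integral (if m = 0 then of_real (2 * pi) else 0)) {0..2 * pi}"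
proof (cases "m = 0")
  case True
  have "((\<lambda>t::real. 1 :: complex) has_integral of_real (2 * pi - 0)) {0..2 * pi}"
    using has_integral_const_real[of "1::complex" 0 "2*pi"] by (simp add: scaleR_conv_of_real)
  then show ?thesis using True by simp
next
  case False
  have "((\<lambda>t. cis (of_int m * t)) has_integral
      (cis (of_int m * (2 * pi)) / (\<i> * of_int m) - cis (of_int m * 0) / (\<i> * of_int m))) {0..2 * pi}"
  proof (rule fundamental_theorem_of_calculus)
    fix t :: real
    have "((\<lambda>z. exp (\<i> * of_int m * z) / (\<i> * of_int m)) has_field_derivative exp (\<i> * of_int m * of_real t))
        (at (of_real t))"
      using False by (auto intro!: derivative_eq_intros)
    from has_vector_derivative_real_field[OF this]
    show "((\<lambda>t. cis (of_int m * t) / (\<i> * of_int m)) has_vector_derivative cis (of_int m * t))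
        (at t within {0..2 * pi})"
      by (simp add: cis_conv_exp mult_ac)
  qed simp
  moreover have "cis (of_int m * (2 * pi)) = 1"
    using cis_multiple_2pi[of "of_int m"] by (simp add: mult_ac)
  ultimately show ?thesis using False by simp
qed

lemma parseval_trigonometric_polynomial:
  fixes a :: "nat \<Rightarrow> complex"
  shows "((\<lambda>t. (norm (\<Sum>n<N. a n * cis (real n * t)))\<^sup>2) has_integral
           2 * pi * (\<Sum>n<N. (norm (a n))\<^sup>2)) {0..2 * pi}"
proof -
  have "((\<lambda>t. \<Sum>k<N. \<Sum>l<N. a k * cnj (a l) * cis (of_int (int k - int l) * t)) has_integral
     (\<Sum>k<N. \<Sum>l<N. a k * cnj (a l) * (if int k - int l = 0 then of_real (2 * pi) else 0))) {0..2 * pi}"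
    by (intro has_integral_sum has_integral_mult_right has_integral_cis_int finite_lessThan)
  also have "(\<lambda>t. \<Sum>k<N. \<Sum>l<N. a k * cnj (a l) * cis (of_int (int k - int l) * t)) =
     (\<lambda>t. of_real ((norm (\<Sum>n<N. a n * cis (real n * t)))\<^sup>2))"
  proof
    fix t
    have "complex_of_real ((norm (\<Sum>n<N. a n * cis (real n * t)))\<^sup>2) =
      (\<Sum>k<N. a k * cis (real k * t)) * (\<Sum>l<N. cnj (a l) * cis (- (real l * t)))"
      unfolding complex_norm_square by (simp add: cis_cnj)
    also have "\<dots> = (\<Sum>k<N. \<Sum>l<N. a k * cnj (a l) * cis (of_int (int k - int l) * t))"
      unfolding sum_product
    proof (intro sum.cong refl)
      fix k l
      have "cis (of_int (int k - int l) * t) = cis (real k * t) * cis (- (real l * t))"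
        by (simp add: cis_mult left_diff_distrib)
      then show "a k * cis (real k * t) * (cnj (a l) * cis (- (real l * t))) =
          a k * cnj (a l) * cis (of_int (int k - int l) * t)"
        by (simp only: mult_ac)
    qed
    finally show "(\<Sum>k<N. \<Sum>l<N. a k * cnj (a l) * cis (of_int (int k - int l) * t)) =
      of_real ((norm (\<Sum>n<N. a n * cis (real n * t)))\<^sup>2)" by simp
  qed
  also have "(\<Sum>k<N. \<Sum>l<N. a k * cnj (a l) * (if int k - int l = 0 then of_real (2 * pi) else 0)) =
      of_real (2 * pi * (\<Sum>n<N. (norm (a n))\<^sup>2))"
  proof -
    have "(\<Sum>l<N. a k * cnj (a l) * (if int k - int l = 0 then of_real (2 * pi) else 0)) =
        of_real (2 * pi * (norm (a k))\<^sup>2)" if "k < N" for k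
    proof -
      have "(\<Sum>l<N. a k * cnj (a l) * (if int k - int l = 0 then of_real (2 * pi) else 0)) =
         (\<Sum>l<N. if k = l then a k * cnj (a l) * of_real (2 * pi) else 0)"
        by (intro sum.cong) auto
      also have "\<dots> = a k * cnj (a k) * of_real (2 * pi)" using that by simp
      finally show ?thesis by (simp only: of_real_mult complex_norm_square mult_ac)
    qed
    then show ?thesis by (simp add: sum_distrib_left)
  qed
  finally show ?thesis by (auto dest: has_integral_Re)
qed

text \<open>
  The partial sums converge uniformly by the M-test and their limit is bounded, so their squared
  moduli converge uniformly as well, and integration commutes with the limit.
\<close>

lemma parseval_absolutely_summable:
  fixes a :: "nat \<Rightarrow> complex"
  assumes "summable (\<lambda>n. norm (a n))"
  shows "((\<lambda>t. (norm (\<Sum>n. a n * cis (real n * t)))\<^sup>2) has_integral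
           2 * pi * (\<Sum>n. (norm (a n))\<^sup>2)) {0..2 * pi}"
    and "summable (\<lambda>n. (norm (a n))\<^sup>2)"
proof -
  define S where "S = (\<lambda>t. \<Sum>n. a n * cis (real n * t))"
  have lim: "uniform_limit {0..2*pi} (\<lambda>N t. \<Sum>n<N. a n * cis (real n * t)) S sequentially"
    unfolding S_def by (rule Weierstrass_m_test[OF _ assms]) (simp add: norm_mult)
  have "norm (S t) \<le> (\<Sum>n. norm (a n))" for t
    unfolding S_def by (rule norm_suminf_le[OF _ assms]) (simp add: norm_mult)
  then have bdd: "bounded (S ` {0..2*pi})" unfolding bounded_iff by blast
  have lim2: "uniform_limit {0..2*pi} (\<lambda>N t. (norm (\<Sum>n<N. a n * cis (real n * t)))\<^sup>2)
      (\<lambda>t. (norm (S t))\<^sup>2) sequentially"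
    unfolding power2_eq_square
    by (intro uniform_lim_mult uniform_limit_intros lim) (use bdd in \<open>auto simp: bounded_iff\<close>)
  obtain I J where IJ: "\<And>N. ((\<lambda>t. (norm (\<Sum>n<N. a n * cis (real n * t)))\<^sup>2) has_integral I N) {0..2*pi}"
    "((\<lambda>t. (norm (S t))\<^sup>2) has_integral J) {0..2*pi}" "I \<longlonglongrightarrow> J"
    by (rule uniform_limit_integral[OF lim2]) (auto intro!: continuous_intros)
  have "I N = 2 * pi * (\<Sum>n<N. (norm (a n))\<^sup>2)" for N
    using has_integral_unique[OF IJ(1) parseval_trigonometric_polynomial] .
  then have "(\<lambda>N. (\<Sum>n<N. (norm (a n))\<^sup>2)) \<longlonglongrightarrow> J / (2 * pi)"
    using tendsto_divide[OF IJ(3) tendsto_const[of "2*pi"]] by simp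
  then have s: "(\<lambda>n. (norm (a n))\<^sup>2) sums (J / (2 * pi))" by (simp add: sums_def)
  then show "summable (\<lambda>n. (norm (a n))\<^sup>2)" by (rule sums_summable)
  from s have "2 * pi * (\<Sum>n. (norm (a n))\<^sup>2) = J" by (simp add: sums_iff)
  with IJ(2) show "((\<lambda>t. (norm (\<Sum>n. a n * cis (real n * t)))\<^sup>2) has_integral
           2 * pi * (\<Sum>n. (norm (a n))\<^sup>2)) {0..2 * pi}" by (simp add: S_def)
qed

text \<open>
  Domination of one function by another on the circle transfers to their coefficients in the
  square mean; it does not transfer to the sums of the absolute values of the coefficients.
\<close>

lemma sum_squares_le_of_pointwise_bound:
  fixes a b :: "nat \<Rightarrow> complex"
  assumes a: "summable (\<lambda>n. norm (a n))" and b: "summable (\<lambda>n. norm (b n))"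
    and le: "\<And>t. norm (\<Sum>n. a n * cis (real n * t)) \<le> K * norm (\<Sum>n. b n * cis (real n * t))"
  shows "(\<Sum>n. (norm (a n))\<^sup>2) \<le> K\<^sup>2 * (\<Sum>n. (norm (b n))\<^sup>2)"
proof -
  have "2 * pi * (\<Sum>n. (norm (a n))\<^sup>2) \<le> K\<^sup>2 * (2 * pi * (\<Sum>n. (norm (b n))\<^sup>2))"
  proof (rule has_integral_le[OF parseval_absolutely_summable(1)[OF a]
        has_integral_mult_right[OF parseval_absolutely_summable(1)[OF b]]])
    fix t :: real
    show "(norm (\<Sum>n. a n * cis (real n * t)))\<^sup>2 \<le> K\<^sup>2 * (norm (\<Sum>n. b n * cis (real n * t)))\<^sup>2"
      using power_mono[OF le norm_ge_zero, of t 2] by (simp add: power_mult_distrib)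
  qed
  then show ?thesis by (simp add: mult_ac)
qed

section \<open>The binomial series of \<open>(1 - z)\<^bsup>-\<beta>\<^esup>\<close>\<close>

text \<open>
  These are the coefficients of \<open>(1 - z)\<^bsup>-\<beta>\<^esup>\<close>; multiplied by \<open>n\<^bsup>1-\<beta>\<^esup>\<close> they converge to \<open>1 / \<Gamma>(\<beta>)\<close>.
  It is here that \<open>\<beta> < 1\<close>, that is a pole order less than \<open>s\<close>, enters the argument.
\<close>

lemma tendsto_pochhammer_over_fact:
  fixes \<beta> :: real
  assumes "\<beta> < 1"
  shows "(\<lambda>n. pochhammer \<beta> n / fact n) \<longlonglongrightarrow> 0"
proof -
  have "(\<lambda>n. ((-\<beta>) gchoose n) / ((-1)^n / exp ((-\<beta>+1) * of_real (ln (real n)))))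
      \<longlonglongrightarrow> inverse (Gamma (- (- \<beta>)))"
    by (rule gbinomial_asymptotic)
  moreover have "((-\<beta>) gchoose n) / ((-1)^n / exp ((-\<beta>+1) * of_real (ln (real n)))) =
     (pochhammer \<beta> n / fact n) * exp ((1 - \<beta>) * ln (real n))" for n
    by (cases "even n") (simp_all add: gbinomial_pochhammer)
  ultimately have 1: "(\<lambda>n. (pochhammer \<beta> n / fact n) * exp ((1 - \<beta>) * ln (real n)))
      \<longlonglongrightarrow> inverse (Gamma \<beta>)"
    by simp
  have 2: "(\<lambda>n. exp (- ((1 - \<beta>) * ln (real n)))) \<longlonglongrightarrow> 0"
    using assms
    by (auto simp: filterlim_uminus_at_bot intro!: filterlim_compose[OF exp_at_bot]
        filterlim_tendsto_pos_mult_at_top[OF tendsto_const]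
        filterlim_compose[OF ln_at_top] filterlim_real_sequentially)
  show ?thesis using tendsto_mult[OF 1 2] by (simp add: mult.assoc flip: exp_add)
qed

lemma sums_one_minus_powr:
  fixes z :: complex and \<beta> :: real
  assumes "norm z < 1"
  shows "(\<lambda>n. of_real (pochhammer \<beta> n / fact n) * z ^ n) sums (1 - z) powr (- of_real \<beta>)"
proof -
  have "(\<lambda>n. ((- of_real \<beta>) gchoose n) * (- z) ^ n) sums (1 + - z) powr (- of_real \<beta>)"
    using assms by (intro gen_binomial_complex) simp
  moreover have "((- of_real \<beta>) gchoose n) * (- z) ^ n = of_real (pochhammer \<beta> n / fact n) * z ^ n" for n
    by (simp add: gbinomial_pochhammer power_minus[of z] pochhammer_of_real)
  ultimately show ?thesis by simp
qed

lemma sums_one_minus_powr_real: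
  fixes y \<beta> :: real
  assumes "\<bar>y\<bar> < 1"
  shows "(\<lambda>n. pochhammer \<beta> n / fact n * y ^ n) sums (1 - y) powr (- \<beta>)"
proof -
  have "(\<lambda>n. ((- \<beta>) gchoose n) * (- y) ^ n) sums (1 + - y) powr (- \<beta>)"
    using assms by (intro gen_binomial_real) simp
  moreover have "((- \<beta>) gchoose n) * (- y) ^ n = pochhammer \<beta> n / fact n * y ^ n" for n
    by (simp add: gbinomial_pochhammer power_minus[of y])
  ultimately show ?thesis by simp
qed

text \<open>
  Squaring a null sequence of coefficients makes it small compared with itself, so the sum of
  squares is of smaller order than \<open>\<Sum>\<^sub>n c\<^sub>n y\<^sup>n = (1 - y)\<^bsup>-\<beta>\<^esup>\<close> up to a constant, the sum of the
  squares of finitely many initial coefficients, beyond which all are below \<open>\<epsilon>\<close>.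
\<close>

lemma sum_squares_binomial_coeffs_little_o:
  fixes \<beta> \<epsilon> :: real
  assumes "0 \<le> \<beta>" "\<beta> < 1" "0 < \<epsilon>"
  obtains C where "\<And>y. 0 \<le> y \<Longrightarrow> y < 1 \<Longrightarrow>
    (\<Sum>n. (pochhammer \<beta> n / fact n)\<^sup>2 * y ^ n) \<le> C + \<epsilon> * (1 - y) powr (- \<beta>)"
proof -
  define c where "c = (\<lambda>n. pochhammer \<beta> n / fact n)"
  have c0: "0 \<le> c n" for n using assms(1) by (simp add: c_def pochhammer_prod prod_nonneg)
  have "c \<longlonglongrightarrow> 0" unfolding c_def by (rule tendsto_pochhammer_over_fact[OF assms(2)])
  then have "eventually (\<lambda>n. c n < \<epsilon>) sequentially" using assms(3) by (rule order_tendstoD)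
  then obtain N where N: "\<And>n. n \<ge> N \<Longrightarrow> c n < \<epsilon>" by (auto simp: eventually_sequentially)
  show thesis
  proof (rule that[of "\<Sum>n<N. (c n)\<^sup>2"])
    fix y :: real assume y: "0 \<le> y" "y < 1"
    define head where "head = (\<lambda>n. if n \<in> {..<N} then (c n)\<^sup>2 else 0)"
    have "head sums (\<Sum>n<N. (c n)\<^sup>2)" unfolding head_def by (rule sums_If_finite_set) simp
    moreover have "(\<lambda>n. c n * y ^ n) sums (1 - y) powr (- \<beta>)"
      unfolding c_def using y by (intro sums_one_minus_powr_real) simp
    ultimately have s: "(\<lambda>n. head n + \<epsilon> * (c n * y ^ n)) sums ((\<Sum>n<N. (c n)\<^sup>2) + \<epsilon> * (1 - y) powr (- \<beta>))"
      by (intro sums_add sums_mult)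
    have le: "(c n)\<^sup>2 * y ^ n \<le> head n + \<epsilon> * (c n * y ^ n)" for n
    proof (cases "n < N")
      case True
      have "(c n)\<^sup>2 * y ^ n \<le> (c n)\<^sup>2" using y by (simp add: mult_left_le power_le_one)
      moreover have "0 \<le> \<epsilon> * (c n * y ^ n)" using y c0 assms(3) by simp
      ultimately show ?thesis using True by (simp add: head_def)
    next
      case False
      then have "c n * (c n * y ^ n) \<le> \<epsilon> * (c n * y ^ n)"
        using N[of n] y c0[of n] by (intro mult_right_mono) auto
      then show ?thesis using False by (simp add: head_def power2_eq_square mult_ac)
    qed
    have "summable (\<lambda>n. (c n)\<^sup>2 * y ^ n)"
      by (rule summable_comparison_test'[OF sums_summable[OF s], of 0]) (use le y in auto)
    from suminf_le[OF le this sums_summable[OF s]]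
    show "(\<Sum>n. (pochhammer \<beta> n / fact n)\<^sup>2 * y ^ n) \<le> (\<Sum>n<N. (c n)\<^sup>2) + \<epsilon> * (1 - y) powr (- \<beta>)"
      using s by (simp add: sums_iff c_def)
  qed
qed

section \<open>Power series with natural coefficients near the point 1\<close>

text \<open>
  Finitely many of the nonzero coefficients, each at least 1, already exceed any given
  bound at \<open>y = 1\<close>, hence also slightly to the left of 1.
\<close>

lemma filterlim_power_series_at_left_1:
  fixes g :: "nat \<Rightarrow> nat"
  assumes inf: "infinite {n. g n \<noteq> 0}"
    and summ: "\<And>y. 0 < y \<Longrightarrow> y < 1 \<Longrightarrow> summable (\<lambda>n. real (g n) * y ^ n)"
  shows "filterlim (\<lambda>y. \<Sum>n. real (g n) * y ^ n) at_top (at_left (1::real))"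
  unfolding filterlim_at_top
proof
  fix B :: real
  obtain T where T: "T \<subseteq> {n. g n \<noteq> 0}" "finite T" "card T = nat \<lceil>B\<rceil> + 1"
    using infinite_arbitrarily_large[OF inf] by blast
  have "B < real (card T)" using T(3) by linarith
  also have "\<dots> \<le> (\<Sum>n\<in>T. real (g n))"
    using sum_mono[of T "\<lambda>_. 1::real" "\<lambda>n. real (g n)"] T(1) by (auto simp: Suc_le_eq)
  finally have B: "B < (\<Sum>n\<in>T. real (g n) * 1 ^ n)" by simp
  have "((\<lambda>y. \<Sum>n\<in>T. real (g n) * y ^ n) \<longlongrightarrow> (\<Sum>n\<in>T. real (g n) * 1 ^ n)) (at_left 1)"
    by (intro tendsto_intros)
  then have "eventually (\<lambda>y. B < (\<Sum>n\<in>T. real (g n) * y ^ n)) (at_left 1)"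
    using B by (rule order_tendstoD)
  moreover have "eventually (\<lambda>y. y \<in> {0<..<1}) (at_left (1::real))"
    by (rule eventually_at_left_real) simp
  ultimately show "eventually (\<lambda>y. B \<le> (\<Sum>n. real (g n) * y ^ n)) (at_left 1)"
  proof eventually_elim
    case (elim y)
    have "(\<Sum>n\<in>T. real (g n) * y ^ n) \<le> (\<Sum>n. real (g n) * y ^ n)"
      using elim T(2) by (intro sum_le_suminf summ) auto
    with elim show ?case by linarith
  qed
qed

lemma eq_powr_if_power_mult_power_eq:
  fixes u d p :: real
  assumes "0 < s" "0 \<le> u" "0 < d" "u ^ s * d ^ t = p"
  shows "u = p powr (1 / s) * d powr (- (t / s))"
proof -
  have "p powr (1 / s) = (u ^ s) powr (1 / s) * (d ^ t) powr (1 / s)"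
    using assms by (simp add: powr_mult flip: assms(4))
  also have "(u ^ s) powr (1 / s) = u"
    using assms by (cases "u = 0") (simp_all add: powr_powr flip: powr_realpow)
  also have "(d ^ t) powr (1 / s) = d powr (t / s)"
    using assms by (simp add: powr_powr flip: powr_realpow)
  finally show ?thesis using assms(3) by (simp add: powr_minus)
qed

text \<open>
  Parseval's identity on the circle of radius \<open>\<surd>y\<close>, combined with the integrality of the
  coefficients in the form \<open>g\<^sub>n \<le> g\<^sub>n\<^sup>2\<close>.
\<close>

lemma sum_squares_le_if_dominated_by_binomial:
  fixes g :: "nat \<Rightarrow> nat" and \<beta> K y :: real
  assumes F: "F = Abs_fps (\<lambda>n. of_nat (g n) :: complex)" "1 \<le> fps_conv_radius F"
    and bound: "\<And>z. norm z < 1 \<Longrightarrow> norm (eval_fps F z) \<le> K * norm (1 - z) powr (- \<beta>)"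
    and y: "0 < y" "y < 1"
  shows "(\<Sum>n. real (g n) * y ^ n) \<le> K\<^sup>2 * (\<Sum>n. (pochhammer \<beta> n / fact n)\<^sup>2 * y ^ n)"
proof -
  define x where "x = sqrt y"
  have x: "0 < x" "x < 1" "x\<^sup>2 = y" using y by (auto simp: x_def real_sqrt_lt_1_iff)
  have xn: "(x ^ n)\<^sup>2 = y ^ n" for n by (metis x(3) power_mult mult.commute)
  define a where "a = (\<lambda>n. of_nat (g n) * of_real (x ^ n) :: complex)"
  define b where "b = (\<lambda>n. of_real (pochhammer \<beta> n / fact n) * of_real (x ^ n) :: complex)"
  have radius: "ereal (norm z) < fps_conv_radius F" if "norm z < 1" for z
    using less_le_trans[OF _ F(2)] that by simp
  have a: "summable (\<lambda>n. norm (a n))"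
    using norm_summable_fps[OF radius[of "of_real x"]] x by (simp add: a_def F(1))
  have b: "summable (\<lambda>n. norm (b n))"
  proof -
    \<comment> \<open>Convergence at a point of larger modulus gives absolute convergence at \<open>x\<close>.\<close>
    have half: "norm (complex_of_real ((1 + x) / 2)) = (1 + x) / 2" using x unfolding norm_of_real by simp
    have "summable (\<lambda>n. norm (of_real (pochhammer \<beta> n / fact n) * (of_real x :: complex) ^ n))"
      by (rule powser_insidea[OF sums_summable[OF sums_one_minus_powr[of "of_real ((1 + x) / 2)"]]])
        (use x in \<open>simp_all only: half norm_of_real, simp_all\<close>)
    then show ?thesis by (simp add: b_def)
  qed
  have "norm (\<Sum>n. a n * cis (real n * t)) \<le> K * norm (\<Sum>n. b n * cis (real n * t))" for t
  proof -
    define z where "z = of_real x * cis t"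
    have z: "norm z < 1" using x by (simp add: z_def norm_mult)
    have zn: "z ^ n = of_real (x ^ n) * cis (real n * t)" for n
      by (simp only: z_def power_mult_distrib Complex.DeMoivre of_real_power)
    have "(\<Sum>n. a n * cis (real n * t)) = eval_fps F z"
      by (simp add: eval_fps_def F(1) a_def zn mult.assoc del: of_real_power)
    moreover have "(\<Sum>n. b n * cis (real n * t)) = (1 - z) powr (- of_real \<beta>)"
      using sums_unique[OF sums_one_minus_powr[OF z, of \<beta>]]
      by (simp add: b_def zn mult.assoc del: of_real_power)
    moreover have "norm ((1 - z) powr (- of_real \<beta>)) = norm (1 - z) powr (- \<beta>)"
      by (subst norm_powr_real_powr') auto
    ultimately show ?thesis using bound[OF z] by simp
  qed
  then have "(\<Sum>n. (norm (a n))\<^sup>2) \<le> K\<^sup>2 * (\<Sum>n. (norm (b n))\<^sup>2)"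
    by (rule sum_squares_le_of_pointwise_bound[OF a b])
  moreover have "(norm (b n))\<^sup>2 = (pochhammer \<beta> n / fact n)\<^sup>2 * y ^ n" for n
    by (simp only: b_def norm_mult norm_of_real power_mult_distrib power2_abs xn)
  moreover have sq: "(norm (a n))\<^sup>2 = (real (g n))\<^sup>2 * y ^ n" for n
    using x by (simp add: a_def norm_mult norm_power power_mult_distrib xn[symmetric])
  moreover have "(\<Sum>n. real (g n) * y ^ n) \<le> (\<Sum>n. (norm (a n))\<^sup>2)"
  proof (rule suminf_le)
    show "real (g n) * y ^ n \<le> (norm (a n))\<^sup>2" for n
    proof -
      have "real (g n) \<le> (real (g n))\<^sup>2"
        by (cases "g n") (simp_all add: power2_eq_square algebra_simps)
      then show ?thesis unfolding sq using y by (intro mult_right_mono) auto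
    qed
    show "summable (\<lambda>n. real (g n) * y ^ n)"
      using norm_summable_fps[OF radius[of "of_real y"]] y by (simp add: F(1) norm_mult norm_power)
    show "summable (\<lambda>n. (norm (a n))\<^sup>2)" by (rule parseval_absolutely_summable(2)[OF a])
  qed
  ultimately show ?thesis by simp
qed

text \<open>
  An \<open>s\<close>-th root of a function with a pole of order \<open>t < s\<close> at 1 would grow like
  \<open>(1 - y)\<^bsup>-t/s\<^esup>\<close> towards 1, which is more than the square-mean estimate leaves room for: the
  lower bound \<open>\<kappa> (1 - y)\<^bsup>-\<beta>\<^esup>\<close> and the upper bound \<open>K\<^sup>2 (C + \<epsilon> (1 - y)\<^bsup>-\<beta>\<^esup>)\<close> keep the series
  bounded, against its divergence at 1. If \<open>t = 0\<close>, the value \<open>P(1)\<close> may vanish and only the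
  upper bound is available, but then it is a constant.
\<close>

lemma nat_power_series_root_of_rational_pole_order:
  fixes g :: "nat \<Rightarrow> nat" and P :: "complex poly"
  assumes inf: "infinite {n. g n \<noteq> 0}"
    and F: "F = Abs_fps (\<lambda>n. of_nat (g n) :: complex)" "1 \<le> fps_conv_radius F"
    and eq: "F ^ s * (1 - fps_X) ^ t = fps_of_poly P"
    and P1: "t = 0 \<or> poly P 1 \<noteq> 0"
  shows "s \<le> t"
proof (rule ccontr)
  assume "\<not> s \<le> t"
  then have ts: "t < s" and s: "0 < s" by auto
  define \<beta> where "\<beta> = real t / real s"
  have \<beta>: "0 \<le> \<beta>" "\<beta> < 1" using ts by (auto simp: \<beta>_def)
  define S where "S = (\<lambda>y. \<Sum>n. real (g n) * y ^ n)"
  have radius: "ereal (norm z) < fps_conv_radius F" if "norm z < 1" for z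
    using less_le_trans[OF _ F(2)] that by simp
  have summ: "summable (\<lambda>n. real (g n) * y ^ n)" if "0 < y" "y < 1" for y
    using norm_summable_fps[OF radius[of "of_real y"]] that by (simp add: F(1) norm_mult norm_power)
  have lim: "filterlim S at_top (at_left 1)"
    unfolding S_def by (rule filterlim_power_series_at_left_1[OF inf summ])
  have evalS: "norm (eval_fps F (of_real y)) = S y" if y: "0 < y" "y < 1" for y
  proof -
    have "eval_fps F (of_real y) = of_real (S y)"
      unfolding eval_fps_def S_def F(1)
      using suminf_of_real[OF summ[OF y], where 'a=complex] by simp
    moreover have "0 \<le> S y" unfolding S_def using y by (intro suminf_nonneg summ) auto
    ultimately show ?thesis by simp
  qed
  have eval: "norm (eval_fps F z) = norm (poly P z) powr (1 / s) * norm (1 - z) powr (- \<beta>)"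
    if z: "norm z < 1" for z
  proof -
    have X: "(1 - fps_X) ^ t = fps_of_poly ([:1, -1:] ^ t :: complex poly)"
      by (simp add: fps_of_poly_power fps_of_poly_pCons)
    have "eval_fps F z ^ s * (1 - z) ^ t = eval_fps (F ^ s * (1 - fps_X) ^ t) z"
      using radius[OF z] less_le_trans[OF radius[OF z] fps_conv_radius_power]
      by (simp add: X eval_fps_mult eval_fps_power)
    then have "eval_fps F z ^ s * (1 - z) ^ t = poly P z" by (simp add: eq)
    from arg_cong[OF this, of norm]
    have "norm (eval_fps F z) ^ s * norm (1 - z) ^ t = norm (poly P z)"
      by (simp add: norm_mult norm_power)
    moreover have "z \<noteq> 1" using z by auto
    ultimately show ?thesis
      unfolding \<beta>_def by (intro eq_powr_if_power_mult_power_eq s) auto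
  qed
  have "bounded (poly P ` cball 0 1)"
    by (intro compact_imp_bounded compact_continuous_image continuous_intros compact_cball)
  then obtain B where "\<forall>z\<in>cball 0 1. norm (poly P z) \<le> B" by (auto simp: bounded_iff)
  then have B: "norm (poly P z) \<le> B" if "norm z \<le> 1" for z using that by simp
  define K where "K = B powr (1 / s)"
  have upper: "norm (eval_fps F z) \<le> K * norm (1 - z) powr (- \<beta>)" if "norm z < 1" for z
    unfolding eval[OF that] K_def using B[of z] that by (intro mult_right_mono powr_mono2) auto
  have near1: "eventually (\<lambda>y. y \<in> {0<..<1}) (at_left (1::real))"
    by (rule eventually_at_left_real) simp
  have "\<exists>D. eventually (\<lambda>y. S y \<le> D) (at_left 1)"
  proof (cases "t = 0")
    case True
    have "eventually (\<lambda>y. S y \<le> K) (at_left 1)"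
      using near1
    proof eventually_elim
      case (elim y)
      then show ?case using upper[of "of_real y"] evalS[of y] True
        by (auto simp: \<beta>_def split: if_splits)
    qed
    then show ?thesis ..
  next
    case False
    define \<delta> where "\<delta> = norm (poly P 1) / 2"
    have \<delta>: "0 < \<delta>" "\<delta> < norm (poly P 1)" using P1 False by (auto simp: \<delta>_def)
    define \<kappa> where "\<kappa> = \<delta> powr (1 / s)"
    have \<kappa>: "0 < \<kappa>" using \<delta> by (simp add: \<kappa>_def)
    have "((\<lambda>y. norm (poly P (of_real y))) \<longlongrightarrow> norm (poly P (of_real 1))) (at_left 1)"
      by (intro tendsto_intros)
    then have "eventually (\<lambda>y. \<delta> < norm (poly P (of_real y))) (at_left 1)"
      using \<delta> by (intro order_tendstoD) auto
    moreover
    \<comment> \<open>Chosen so that the \<open>\<epsilon>\<close>-term of the upper bound is at most half of the lower bound.\<close>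
    define \<epsilon> where "\<epsilon> = \<kappa> / (K\<^sup>2 + 1) / 2"
    have \<epsilon>: "0 < \<epsilon>" using \<kappa> by (simp add: \<epsilon>_def add_nonneg_pos)
    have "K\<^sup>2 * \<epsilon> \<le> \<kappa> / 2"
    proof -
      have "\<kappa> * K\<^sup>2 \<le> \<kappa> * (K\<^sup>2 + 1)" using \<kappa> by simp
      then have "\<kappa> * K\<^sup>2 / (K\<^sup>2 + 1) \<le> \<kappa>" by (simp add: pos_divide_le_eq add_nonneg_pos)
      then have "\<kappa> * K\<^sup>2 / (K\<^sup>2 + 1) / 2 \<le> \<kappa> / 2" by (rule divide_right_mono) simp
      then show ?thesis unfolding \<epsilon>_def by (simp only: times_divide_eq_right mult.commute)
    qed
    obtain C where C: "\<And>y. 0 \<le> y \<Longrightarrow> y < 1 \<Longrightarrow>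
        (\<Sum>n. (pochhammer \<beta> n / fact n)\<^sup>2 * y ^ n) \<le> C + \<epsilon> * (1 - y) powr (- \<beta>)"
      using sum_squares_binomial_coeffs_little_o[OF \<beta> \<epsilon>] by blast
    have "eventually (\<lambda>y. S y \<le> 2 * (K\<^sup>2 * C)) (at_left 1)"
      using near1 calculation
    proof eventually_elim
      case (elim y)
      then have y: "0 < y" "y < 1" by auto
      have "\<kappa> * (1 - y) powr (- \<beta>) \<le> norm (poly P (of_real y)) powr (1 / s) * (1 - y) powr (- \<beta>)"
        unfolding \<kappa>_def using elim(2) \<delta> by (intro mult_right_mono powr_mono2) auto
      also have "\<dots> = S y"
      proof -
        have "norm (1 - complex_of_real y) = 1 - y"
          using y norm_of_real[of "1 - y", where 'a=complex] by simp
        then show ?thesis using eval[of "of_real y"] evalS[OF y] y by simp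
      qed
      finally have low: "\<kappa> * (1 - y) powr (- \<beta>) \<le> S y" .
      have "S y \<le> K\<^sup>2 * (\<Sum>n. (pochhammer \<beta> n / fact n)\<^sup>2 * y ^ n)"
        unfolding S_def by (rule sum_squares_le_if_dominated_by_binomial[OF F upper y])
      also have "\<dots> \<le> K\<^sup>2 * (C + \<epsilon> * (1 - y) powr (- \<beta>))"
        using C[of y] y by (intro mult_left_mono) auto
      also have "\<dots> = K\<^sup>2 * C + (K\<^sup>2 * \<epsilon>) * (1 - y) powr (- \<beta>)" by (simp add: algebra_simps)
      also have "\<dots> \<le> K\<^sup>2 * C + \<kappa> / 2 * (1 - y) powr (- \<beta>)"
        using \<open>K\<^sup>2 * \<epsilon> \<le> \<kappa> / 2\<close> by (intro add_left_mono mult_right_mono) auto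
      also have "\<dots> \<le> K\<^sup>2 * C + S y / 2" using low by simp
      finally show ?case by simp
    qed
    then show ?thesis ..
  qed
  then obtain D where "eventually (\<lambda>y. S y \<le> D) (at_left 1)" ..
  moreover have "eventually (\<lambda>y. D + 1 \<le> S y) (at_left 1)"
    using lim unfolding filterlim_at_top by blast
  ultimately have "eventually (\<lambda>y::real. False) (at_left 1)"
    by eventually_elim simp
  then show False by (simp add: trivial_limit_at_left_real)
qed

section \<open>Eventually polynomial coefficients\<close>

text \<open>
  Multiplication by \<open>1 - X\<close> replaces the coefficients by their backward differences, which lowers
  the degree of the polynomial; after \<open>d\<close> steps only finitely many coefficients are left.
\<close>

lemma eventually_poly_coeffs_mult_one_minus_X_power:
  fixes F :: "'a :: field_char_0 fps"
  assumes "\<forall>n>N. fps_nth F n = poly q (of_nat n)" and "q = 0 \<or> degree q < d"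
  shows "\<exists>P. F * (1 - fps_X) ^ d = fps_of_poly P"
  using assms
proof (induction d arbitrary: F q N)
  case 0
  have "F = fps_of_poly (\<Sum>n\<le>N. monom (fps_nth F n) n)"
    using 0 by (intro fps_ext) (auto simp: coeff_sum)
  then show ?case by auto
next
  case (Suc d)
  define q' where "q' = q - pcompose q [:-1, 1:]"
  have "fps_nth (F * (1 - fps_X)) n = poly q' (of_nat n)" if n: "n > Suc N" for n
  proof -
    obtain k where k: "n = Suc k" "k > N" using n by (cases n) auto
    have "fps_nth (F * (1 - fps_X)) n = fps_nth F n - fps_nth F k"
      using k by (simp add: right_diff_distrib)
    then show ?thesis using Suc.prems(1) k by (simp add: q'_def poly_pcompose)
  qed
  moreover have "q' = 0 \<or> degree q' < d"
  proof (cases "degree q = 0")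
    case True
    then show ?thesis by (auto simp: q'_def elim: degree_eq_zeroE)
  next
    case False
    have le: "degree q' \<le> degree q" unfolding q'_def by (rule degree_diff_le) (simp_all add: degree_pcompose)
    have "coeff (pcompose q [:-1, 1:]) (degree q) = lead_coeff q"
      using lead_coeff_comp[of "[:-1, 1:]" q] by (simp add: degree_pcompose)
    then have "coeff q' (degree q) = 0" by (simp add: q'_def)
    then have "q' = 0 \<or> degree q' \<noteq> degree q" by (metis leading_coeff_0_iff)
    then show ?thesis using le Suc.prems(2) False by auto
  qed
  ultimately have "\<exists>P. F * (1 - fps_X) * (1 - fps_X) ^ d = fps_of_poly P"
    by (intro Suc.IH[of "Suc N" _ q']) auto
  then show ?case by (simp add: mult.assoc)
qed

text \<open>
  Of all representations \<open>P / (1 - X)\<^sup>t\<close> of the \<open>s\<close>-th power, the one with the least \<open>t\<close> has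
  \<open>P(1) \<noteq> 0\<close> or \<open>t = 0\<close>, since otherwise a factor \<open>1 - X\<close> could be cancelled.
\<close>

lemma power_coeffs_not_eventually_poly:
  fixes g :: "nat \<Rightarrow> nat"
  assumes inf: "infinite {n. g n \<noteq> 0}"
    and F: "F = Abs_fps (\<lambda>n. of_nat (g n) :: complex)" "1 \<le> fps_conv_radius F"
    and s: "0 < s" and q: "q = 0 \<or> degree q < s - 1"
    and coeffs: "\<forall>n>N. fps_nth (F ^ s) n = poly q (of_nat n)"
  shows False
proof -
  define t where "t = (LEAST t. \<exists>P. F ^ s * (1 - fps_X) ^ t = fps_of_poly P)"
  have ex: "\<exists>P. F ^ s * (1 - fps_X) ^ (s - 1) = fps_of_poly P"
    by (rule eventually_poly_coeffs_mult_one_minus_X_power[OF coeffs q])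
  then have "t \<le> s - 1" unfolding t_def by (rule Least_le)
  obtain P where P: "F ^ s * (1 - fps_X) ^ t = fps_of_poly P"
    using LeastI[of "\<lambda>t. \<exists>P. F ^ s * (1 - fps_X) ^ t = fps_of_poly P", OF ex]
    unfolding t_def[symmetric] by blast
  have "t = 0 \<or> poly P 1 \<noteq> 0"
  proof (rule ccontr)
    assume "\<not> (t = 0 \<or> poly P 1 \<noteq> 0)"
    then obtain t' where t': "t = Suc t'" and P1: "poly P 1 = 0" by (cases t) auto
    from P1 obtain Q where Q: "P = [:-1, 1:] * Q" by (auto simp: poly_eq_0_iff_dvd elim: dvdE)
    have "fps_of_poly P = (1 - fps_X) * fps_of_poly (- Q)"
      unfolding Q fps_of_poly_mult by (simp add: fps_of_poly_pCons fps_of_poly_uminus algebra_simps)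
    then have "(1 - fps_X) * (F ^ s * (1 - fps_X) ^ t') = (1 - fps_X) * fps_of_poly (- Q)"
      using P by (simp only: t' power_Suc mult_ac)
    moreover have "(1 - fps_X :: complex fps) \<noteq> 0"
      by (auto simp: fps_eq_iff intro!: exI[of _ 0])
    ultimately have "F ^ s * (1 - fps_X) ^ t' = fps_of_poly (- Q)" by simp
    then have "t \<le> t'" unfolding t_def by (intro Least_le) blast
    then show False using t' by simp
  qed
  from nat_power_series_root_of_rational_pole_order[OF inf F P this] \<open>t \<le> s - 1\<close> s
  show False by simp
qed

section \<open>Generating functions of weighted sums\<close>

lemma finite_weighted_sum_solutions:
  fixes w :: "'i \<Rightarrow> nat" and A :: "nat set"
  assumes "finite I" and "\<And>i. i \<in> I \<Longrightarrow> 0 < w i"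
  shows "finite {a \<in> I \<rightarrow>\<^sub>E A. n = (\<Sum>i\<in>I. w i * a i)}" (is "finite ?S")
proof (rule finite_subset)
  show "?S \<subseteq> I \<rightarrow>\<^sub>E {..n}"
  proof
    fix a assume a: "a \<in> ?S"
    have "a j \<le> n" if "j \<in> I" for j
    proof -
      have "a j \<le> w j * a j" using assms(2)[OF that] by simp
      also have "\<dots> \<le> (\<Sum>i\<in>I. w i * a i)"
        using assms(1) that by (intro member_le_sum) auto
      finally show ?thesis using a by simp
    qed
    then show "a \<in> I \<rightarrow>\<^sub>E {..n}" using a by (auto simp: PiE_iff)
  qed
  show "finite (I \<rightarrow>\<^sub>E {..n})" using assms(1) by (simp add: finite_PiE)
qed

text \<open>
  The factor belonging to \<open>i\<close> is \<open>f(z\<^bsup>w i\<^esup>)\<close>, where \<open>f\<close> is the generating function of \<open>A\<close>. Both the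
  full configuration and the one with all multiplicities divided by \<open>s\<close> are instances, differing
  only in the index set \<open>I\<close>.
\<close>

lemma fps_nth_prod_dilated_indicator:
  fixes w :: "'i \<Rightarrow> nat" and A :: "nat set"
  assumes "finite I" and "\<And>i. i \<in> I \<Longrightarrow> 0 < w i"
  shows "fps_nth (\<Prod>i\<in>I. Abs_fps (\<lambda>n. if n \<in> (*) (w i) ` A then 1 else (0::'a::comm_semiring_1))) n =
    of_nat (card {a \<in> I \<rightarrow>\<^sub>E A. n = (\<Sum>i\<in>I. w i * a i)})"
  using assms
proof (induction I arbitrary: n rule: finite_induct)
  case empty
  have "{a \<in> {} \<rightarrow>\<^sub>E A. n = (\<Sum>i\<in>{}. w i * a i)} = (if n = 0 then {\<lambda>_. undefined} else {})" by auto
  then show ?case by auto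
next
  case (insert i I)
  define S where "S = (\<lambda>I n. {a \<in> I \<rightarrow>\<^sub>E A. n = (\<Sum>i\<in>I. w i * a i)})"
  define X where "X = {x \<in> A. w i * x \<le> n}"
  define h where "h = (\<lambda>(x::nat, a). a(i := x))"
  have wi: "w i > 0" using insert.prems by simp
  have finX: "finite X"
  proof (rule finite_subset)
    have "x \<le> w i * x" for x using wi by simp
    then show "X \<subseteq> {..n}" unfolding X_def using order_trans by blast
  qed simp
  have finS: "finite (S I m)" for m
    unfolding S_def using insert.hyps(1) insert.prems by (intro finite_weighted_sum_solutions) auto
  have inj: "inj_on h (SIGMA x:X. S I (n - w i * x))"
    unfolding h_def
    by (rule inj_on_subset[OF inj_combinator[OF insert.hyps(2), of "\<lambda>_. A"]]) (auto simp: X_def S_def)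
  have sum_upd: "(\<Sum>j\<in>I. w j * (a(i := x)) j) = (\<Sum>j\<in>I. w j * a j)" for a x
    using insert.hyps(2) by (intro sum.cong) auto
  have img: "h ` (SIGMA x:X. S I (n - w i * x)) = S (insert i I) n"
  proof (intro equalityI subsetI)
    fix b assume "b \<in> h ` (SIGMA x:X. S I (n - w i * x))"
    then show "b \<in> S (insert i I) n"
      using insert.hyps sum_upd by (auto simp: h_def S_def X_def PiE_insert_eq)
  next
    fix b assume b: "b \<in> S (insert i I) n"
    then obtain x a where xa: "x \<in> A" "a \<in> I \<rightarrow>\<^sub>E A" "b = a(i := x)"
      by (auto simp: S_def PiE_insert_eq)
    have "n = w i * x + (\<Sum>j\<in>I. w j * a j)"
      using b insert.hyps sum_upd by (simp add: S_def xa(3))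
    then have "(x, a) \<in> (SIGMA x:X. S I (n - w i * x))" using xa by (auto simp: X_def S_def)
    then show "b \<in> h ` (SIGMA x:X. S I (n - w i * x))" using xa(3) by (force simp: h_def)
  qed
  have "fps_nth (\<Prod>i\<in>insert i I. Abs_fps (\<lambda>n. if n \<in> (*) (w i) ` A then 1 else (0::'a))) n =
      (\<Sum>j\<in>{0..n}. (if j \<in> (*) (w i) ` A then 1 else 0) * of_nat (card (S I (n - j))))"
    using insert.hyps insert.IH insert.prems by (simp add: fps_mult_nth S_def)
  also have "\<dots> = (\<Sum>j\<in>(*) (w i) ` X. of_nat (card (S I (n - j))))"
    by (rule sum.mono_neutral_cong_right) (auto simp: X_def)
  also have "\<dots> = (\<Sum>x\<in>X. of_nat (card (S I (n - w i * x))))"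
    using wi by (subst sum.reindex) (auto simp: inj_on_def)
  also have "\<dots> = of_nat (card (SIGMA x:X. S I (n - w i * x)))"
    using finX finS by simp
  also have "\<dots> = of_nat (card (S (insert i I) n))"
    using card_image[OF inj] img by simp
  finally show ?case unfolding S_def .
qed

lemma fps_conv_radius_prod_ge:
  fixes f :: "'i \<Rightarrow> 'a :: {banach, real_normed_div_algebra, comm_ring_1} fps"
  assumes "\<And>i. i \<in> I \<Longrightarrow> r \<le> fps_conv_radius (f i)"
  shows "r \<le> fps_conv_radius (\<Prod>i\<in>I. f i)"
  using assms
proof (induction I rule: infinite_finite_induct)
  case (insert i I)
  then show ?case
    using order_trans[OF _ fps_conv_radius_mult[of "f i" "prod f I"], of r] by simp
qed auto

lemma fps_conv_radius_indicator_ge_1: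
  "1 \<le> fps_conv_radius (Abs_fps (\<lambda>n. if n \<in> B then 1 else (0 :: complex)))"
  unfolding fps_conv_radius_def
proof (rule conv_radius_geI_ex')
  fix r :: real assume r: "0 < r" "ereal r < 1"
  show "summable (\<lambda>n. fps_nth (Abs_fps (\<lambda>n. if n \<in> B then 1 else (0 :: complex))) n * of_real r ^ n)"
    by (rule summable_comparison_test'[of "\<lambda>n. r ^ n" 0])
      (use r in \<open>auto simp: norm_mult norm_power summable_geometric\<close>)
qed

section \<open>Representation functions of configurations\<close>

theorem theorem1:
  fixes A :: "nat set" and M :: "(nat \<times> nat) set"
  assumes "infinite A" and "\<forall>a\<in>A. 0 < a"
    and "is_configuration M"
  shows "\<not> (\<exists>(q :: complex poly) (N :: nat).
              (q = 0 \<or> degree q < config_degree M - 1) \<and>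
              (\<forall>n>N. of_nat (rep M n A) = poly q (of_nat n)))"
proof (intro notI, elim exE conjE)
  fix q :: "complex poly" and N
  assume q: "q = 0 \<or> degree q < config_degree M - 1"
    and eq: "\<forall>n>N. of_nat (rep M n A) = poly q (of_nat n)"
  define s where "s = config_degree M"
  have finM: "finite M" and M_ne: "M \<noteq> {}" and pos: "\<And>k m. (k, m) \<in> M \<Longrightarrow> 0 < k \<and> 0 < m"
    using assms(3) by (auto simp: is_configuration_def)
  have s_dvd: "s dvd m" if "(k, m) \<in> M" for k m
    unfolding s_def config_degree_def using that by (intro Gcd_dvd) force
  have s0: "0 < s"
  proof -
    obtain k m where "(k, m) \<in> M" using M_ne by auto
    with s_dvd pos show ?thesis by (metis dvd_0_left_iff gr0I less_irrefl)
  qed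
  define w :: "(nat \<times> nat) \<times> nat \<Rightarrow> nat" where "w = (\<lambda>i. fst (fst i))"
  define f where "f = (\<lambda>k::nat. Abs_fps (\<lambda>n. if n \<in> (*) k ` A then 1 else (0::complex)))"
  \<comment> \<open>Multiplicities divided by \<open>e\<close>: for \<open>e = 1\<close> the given equation, for \<open>e = s\<close> the \<open>s\<close>-th root
      of its generating function.\<close>
  define I where "I = (\<lambda>e. SIGMA (k, m):M. {1..m div e})"
  define G where "G = (\<lambda>e. \<Prod>i\<in>I e. f (w i))"
  define g where "g = (\<lambda>e n. card {a \<in> I e \<rightarrow>\<^sub>E A. n = (\<Sum>i\<in>I e. w i * a i)})"
  have finI: "finite (I e)" for e unfolding I_def using finM by (auto intro!: finite_SigmaI)
  have wpos: "0 < w i" if "i \<in> I e" for i e using that pos by (auto simp: I_def w_def)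
  have G_nth: "fps_nth (G e) n = of_nat (g e n)" for e n
    unfolding G_def g_def f_def by (rule fps_nth_prod_dilated_indicator[OF finI wpos])
  have G_prod: "G e = (\<Prod>(k, m)\<in>M. f k ^ (m div e))" for e
  proof -
    have "G e = (\<Prod>p\<in>M. \<Prod>j\<in>{1..snd p div e}. f (fst p))"
      unfolding G_def I_def w_def using finM
      by (subst prod.Sigma) (auto simp: case_prod_unfold)
    then show ?thesis by (simp add: case_prod_unfold)
  qed
  have "G s ^ s = G 1"
    unfolding G_prod prod_power_distrib
  proof (intro prod.cong refl)
    fix p assume "p \<in> M"
    then show "(case p of (k, m) \<Rightarrow> f k ^ (m div s)) ^ s = (case p of (k, m) \<Rightarrow> f k ^ (m div 1))"
      using s_dvd by (cases p) (auto simp flip: power_mult)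
  qed
  moreover have "g 1 n = rep M n A" for n
  proof -
    have "(\<Sum>(k, m)\<in>M. k * (\<Sum>j=1..m. a ((k, m), j))) = (\<Sum>i\<in>I 1. w i * a i)" for a
      unfolding I_def w_def using finM
      by (simp add: sum_distrib_left case_prod_unfold sum.Sigma)
    then show ?thesis unfolding g_def rep_def solutions_def by (simp add: I_def)
  qed
  ultimately have coeffs: "\<forall>n>N. fps_nth (G s ^ s) n = poly q (of_nat n)"
    using eq by (simp add: G_nth)
  have radius: "1 \<le> fps_conv_radius (G s)"
    unfolding G_def f_def by (intro fps_conv_radius_prod_ge fps_conv_radius_indicator_ge_1)
  define W where "W = (\<Sum>i\<in>I s. w i)"
  have "I s \<noteq> {}"
  proof -
    obtain k m where km: "(k, m) \<in> M" using M_ne by auto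
    have "s \<le> m" using dvd_imp_le[OF s_dvd[OF km]] pos[OF km] by simp
    then have "((k, m), 1) \<in> I s" using km s0 by (auto simp: I_def div_greater_zero_iff Suc_le_eq)
    then show ?thesis by auto
  qed
  then have W: "0 < W" unfolding W_def using finI wpos by (intro sum_pos) auto
  \<comment> \<open>Constant tuples with value \<open>x \<in> A\<close> represent \<open>W * x\<close>.\<close>
  have "infinite {n. g s n \<noteq> 0}"
  proof
    assume fin: "finite {n. g s n \<noteq> 0}"
    have "(*) W ` A \<subseteq> {n. g s n \<noteq> 0}"
    proof
      fix n assume "n \<in> (*) W ` A"
      then obtain x where x: "x \<in> A" "n = W * x" by auto
      define T where "T = {a \<in> I s \<rightarrow>\<^sub>E A. n = (\<Sum>i\<in>I s. w i * a i)}"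
      have "(\<lambda>i\<in>I s. x) \<in> T" using x by (simp add: T_def W_def sum_distrib_right)
      moreover have "finite T"
        unfolding T_def by (rule finite_weighted_sum_solutions[OF finI wpos])
      ultimately have "card T \<noteq> 0" by auto
      then show "n \<in> {n. g s n \<noteq> 0}" by (simp add: g_def T_def)
    qed
    then have "finite ((*) W ` A)" using fin finite_subset by blast
    then show False using assms(1) W by (auto dest!: finite_imageD simp: inj_on_def)
  qed
  then show False
    by (rule power_coeffs_not_eventually_poly[OF _ _ radius s0 _ coeffs])
      (use q in \<open>auto simp: fps_eq_iff G_nth s_def\<close>)
qed

end
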